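(* Let $A$ and $B$ be integers and consider the equation \[\sigma_2(n)-n^2=An+B\] in positive integers $n$, where $\sigma_2(n)=\sum_{d\mid n} d^2$. (i) If $A=0$ and $B=1$, then the solutions are exactly the integers $n=p$ with $p$ prime. (ii) If $A=1$ and $B=1$, then the solutions are exactly the integers $n=p^2$ with $p$ prime. (iii) If $(A,B)\neq(0,1)$ and $(A,B)\neq(1,1)$, then every solution $n$ with $n>(|A|+|B|)^3$ is of the form $n=pq$, where $p<q$ are primes satisfying \[p^2+q^2+(1-B)=Apq.\]
   Context: $\sigma_2(n)$ denotes the sum of the squares of the positive divisors of $n$.
   Formalization: Part (iii) excludes the single instance A = B = 0, n = 1, where the claim as written fails: 1 is a solution with 1 > (|A|+|B|)^3 = 0 but is not a product of two primes. *)

theory Defs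
  imports Complex_Main "HOL-Computational_Algebra.Primes"
begin

definition sigma2 :: "nat \<Rightarrow> nat" where
  "sigma2 n = (\<Sum>d | d dvd n. d ^ 2)"

definition solutions :: "int \<Rightarrow> int \<Rightarrow> nat set" where
  "solutions A B = {n. n > 0 \<and> int (sigma2 n) - (int n)^2 = A * int n + B}"

(* For A = B = 0 the number 1 is a solution exceeding (|A| + |B|)^3 = 0, and it is
   not a product of two primes. This instance has to be excluded by hand. *)
lemma one_in_solutions_0_0: "1 \<in> solutions 0 0"
  by (simp add: solutions_def sigma2_def)

end

theory Submission
  imports Defs
begin

text \<open>
  Let \<open>p\<close> be the least prime factor of \<open>n\<close> and \<open>m = n / p\<close>. If \<open>n\<close> has at least three prime
  factors, then \<open>p\<^sup>2 \<le> m\<close>, while the proper divisors \<open>1\<close> and \<open>m\<close> give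
  \<open>m\<^sup>2 < \<sigma>\<^sub>2(n) - n\<^sup>2 = A n + B \<le> K n\<close> with \<open>K = \<bar>A\<bar> + \<bar>B\<bar>\<close>. Hence \<open>m < K p\<close>, so
  \<open>p < K\<close>, \<open>m < K\<^sup>2\<close> and \<open>n < K\<^sup>3\<close>. Numbers with at most two prime factors are treated by
  computing \<open>\<sigma>\<^sub>2\<close>.
\<close>

text \<open>The cases overlap: \<open>three\<close> also holds for some products of two primes. This
  is harmless, since the size estimate for \<open>three\<close> uses only
  \<open>p ^ 2 \<le> m\<close>, not that \<open>m\<close> is composite.\<close>

lemma nat_prime_factor_cases:
  fixes n :: nat
  assumes "n > 0"
  obtains (one) "n = 1"
    | (prime) "prime n"
    | (square) p where "prime p" "n = p ^ 2"
    | (product) p q where "prime p" "prime q" "p < q" "n = p * q"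
    | (three) p m where "prime p" "n = p * m" "p ^ 2 \<le> m"
proof (cases "n = 1")
  case True
  then show ?thesis by (rule one)
next
  case False
  define p where "p = (LEAST p. prime p \<and> p dvd n)"
  have "\<exists>p. prime p \<and> p dvd n"
    using False prime_factor_nat by blast
  then have p: "prime p" "p dvd n"
    unfolding p_def by (metis (mono_tags, lifting) LeastI_ex)+
  have least: "p \<le> r" if "prime r" "r dvd n" for r
    unfolding p_def using that by (simp add: Least_le)
  obtain m where m: "n = p * m"
    using p(2) by (elim dvdE)
  consider "m = 1" | "prime m" | "m \<noteq> 1" "\<not> prime m" by blast
  then show ?thesis
  proof cases
    case 1
    then show ?thesis using p m prime by simp
  next
    case 2
    then have "p \<le> m" using least m by simp
    then show ?thesis
      using p m 2 square product by (cases "p = m") (auto simp: power2_eq_square)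
  next
    case 3
    obtain r where r: "prime r" "r dvd m"
      using 3(1) prime_factor_nat by blast
    obtain t where t: "m = r * t"
      using r(2) by (elim dvdE)
    have "t \<noteq> 1" using 3(2) r t by auto
    then obtain u where u: "prime u" "u dvd t"
      using prime_factor_nat by blast
    have "t > 0" using m t assms by (intro Nat.gr0I) auto
    then have "u \<le> t" using u dvd_imp_le by blast
    \<comment> \<open>\<open>r\<close> and \<open>u\<close> are prime factors of \<open>n\<close> as
      well, so neither is below the least one.\<close>
    have "p \<le> r" "p \<le> u"
      using least r u m t by auto
    then have "p * p \<le> r * t"
      using \<open>u \<le> t\<close> by (intro mult_le_mono) auto
    then show ?thesis
      using three p(1) m t by (simp add: power2_eq_square)
  qed
qed

lemma sum_squares_le_sigma2:
  assumes "n > 0" "\<forall>d\<in>S. d dvd n"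
  shows "(\<Sum>d\<in>S. d ^ 2) \<le> sigma2 n"
  unfolding sigma2_def using assms by (intro sum_mono2) auto

lemma sigma2_prime:
  assumes "prime p"
  shows "sigma2 p = 1 + p ^ 2"
proof -
  have "{d. d dvd p} = {1, p}"
    using assms by (auto simp: prime_nat_iff)
  then show ?thesis
    using prime_gt_1_nat[OF assms] by (simp add: sigma2_def)
qed

lemma sigma2_prime_square:
  assumes "prime p"
  shows "sigma2 (p ^ 2) = 1 + p ^ 2 + (p ^ 2) ^ 2"
proof -
  have p: "p > 1" using assms by (rule prime_gt_1_nat)
  have "{d. d dvd p ^ 2} = (\<lambda>i. p ^ i) ` {..2}"
    using divides_primepow_nat[OF assms] by auto
  also have "\<dots> = {1, p, p ^ 2}"
    by (auto simp: numeral_2_eq_2 atMost_Suc)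
  finally show ?thesis
    using p by (simp add: sigma2_def power2_eq_square)
qed

lemma sigma2_prime_product:
  assumes "prime p" "prime q" "p < q"
  shows "sigma2 (p * q) = 1 + p ^ 2 + q ^ 2 + (p * q) ^ 2"
proof -
  have pq: "p > 1" "q > 1" using assms(1,2) prime_gt_1_nat by blast+
  have "d \<in> {1, p, q, p * q}" if d: "d dvd p * q" for d
  proof -
    obtain a b where ab: "d = a * b" "a dvd p" "b dvd q"
      using division_decomp[OF d] by blast
    then have "a = 1 \<or> a = p" "b = 1 \<or> b = q"
      using assms(1,2) prime_nat_iff by blast+
    then show ?thesis using ab(1) by auto
  qed
  then have "{d. d dvd p * q} = {1, p, q, p * q}" by auto
  then show ?thesis
    using pq assms(3) by (simp add: sigma2_def)
qed

text \<open>The hypothesis forces \<open>m > 1\<close>, so the divisors \<open>1\<close>,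
  \<open>m\<close> and \<open>p * m\<close> are distinct and their squares all count.\<close>

lemma sigma2_three_lower_bound:
  assumes "prime p" "p ^ 2 \<le> m"
  shows "sigma2 (p * m) \<ge> 1 + m ^ 2 + (p * m) ^ 2"
proof -
  have p: "p > 1" using assms(1) by (rule prime_gt_1_nat)
  then have "p ^ 2 > 1" by (intro one_less_power) auto
  then have "m > 1" using assms(2) by simp
  then show ?thesis
    using p sum_squares_le_sigma2[of "p * m" "{1, m, p * m}"] by auto
qed

lemma solution_three_less_cube:
  assumes "prime p" "p ^ 2 \<le> m" "p * m \<in> solutions A B"
  shows "int (p * m) < (\<bar>A\<bar> + \<bar>B\<bar>) ^ 3"
proof -
  define K P M where "K = \<bar>A\<bar> + \<bar>B\<bar>" and "P = int p" and "M = int m"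
  have P: "P > 0" using assms(1) prime_gt_0_nat by (simp add: P_def)
  have PM: "P * P \<le> M"
    using assms(2) unfolding P_def M_def power2_eq_square by (simp flip: of_nat_mult)
  then have M: "M > 0" using P by (meson less_le_trans mult_pos_pos)
  have "int (1 + m ^ 2 + (p * m) ^ 2) \<le> int (sigma2 (p * m))"
    using sigma2_three_lower_bound[OF assms(1,2)] by (simp only: of_nat_le_iff)
  \<comment> \<open>The square of the divisor \<open>1\<close> makes this inequality strict.\<close>
  then have "M * M < A * (P * M) + B"
    using assms(3) by (simp add: solutions_def P_def M_def power2_eq_square)
  also have "\<dots> \<le> \<bar>A\<bar> * (P * M) + \<bar>B\<bar> * (P * M)"
  proof (intro add_mono)
    show "A * (P * M) \<le> \<bar>A\<bar> * (P * M)"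
      using P M by (intro mult_right_mono) auto
    have "1 \<le> P * M" using mult_pos_pos[OF P M] by simp
    then show "B \<le> \<bar>B\<bar> * (P * M)"
      using mult_left_mono[of 1 "P * M" "\<bar>B\<bar>"] by simp
  qed
  also have "\<dots> = (K * P) * M" by (simp add: K_def algebra_simps)
  finally have MK: "M < K * P" using M by simp
  with PM have "P * P < K * P" by simp
  then have PK: "P < K" using P by simp
  have "P * M < K * (K * K)"
  proof (rule mult_strict_mono)
    show "M < K * K"
      using MK PK P by (meson less_le_trans mult_left_mono less_imp_le less_trans)
  qed (use P M PK in auto)
  then show ?thesis
    by (simp add: K_def P_def M_def power3_eq_cube mult.assoc)
qed

lemma solutions_0_1: "solutions 0 1 = {p. prime p}"
proof (intro set_eqI iffI)
  fix n assume n: "n \<in> solutions 0 1"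
  then have "n > 0" by (simp add: solutions_def)
  then show "n \<in> {p. prime p}"
  proof (cases rule: nat_prime_factor_cases)
    case (three p m)
    then have "int n < 1"
      using solution_three_less_cube[of p m 0 1] n by simp
    then show ?thesis using \<open>n > 0\<close> by simp
  qed (use n in \<open>auto simp: solutions_def sigma2_def[of "Suc 0"]
      sigma2_prime_square sigma2_prime_product\<close>)
qed (auto simp: solutions_def sigma2_prime prime_gt_0_nat)

lemma solutions_1_1: "solutions 1 1 = {p ^ 2 | p. prime p}"
proof (intro set_eqI iffI)
  fix n assume n: "n \<in> solutions 1 1"
  then have "n > 0" by (simp add: solutions_def)
  then show "n \<in> {p ^ 2 | p. prime p}"
  proof (cases rule: nat_prime_factor_cases)
    case (product p q)
    then have "int (p * p + q * q) = int (p * q)"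
      using n by (simp add: solutions_def sigma2_prime_product power2_eq_square)
    then have "p * p + q * q = p * q" by (simp only: of_nat_eq_iff)
    moreover have "p * q \<le> q * q" "p * p > 0"
      using product prime_gt_0_nat by auto
    ultimately show ?thesis by linarith
  next
    case (three p m)
    \<comment> \<open>Here the bound is \<open>2 ^ 3\<close>, just missed by the smallest possible
      product \<open>2 * 4\<close>; strictness of the bound matters.\<close>
    then have "int (p * m) < 8"
      using solution_three_less_cube[of p m 1 1] n by simp
    moreover have "2 \<le> p" using three by (simp add: prime_ge_2_nat)
    moreover from this have "4 \<le> m"
      using three power_mono[of 2 p 2] by simp
    ultimately show ?thesis
      using mult_le_mono[of 2 p 4 m] by linarith
  qed (use n in \<open>auto simp: solutions_def sigma2_def[of "Suc 0"] sigma2_prime\<close>)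
qed (auto simp: solutions_def sigma2_prime_square prime_gt_0_nat)

text \<open>A nonzero integer \<open>C\<close> has absolute value at least 1, so
  \<open>n \<le> \<bar>D\<bar>\<close>. This serves primes and squares of primes, for which the
  equation becomes linear in \<open>n\<close>.\<close>

lemma le_cube_of_mult_eq:
  fixes C D K n :: int
  assumes "C * n = D" "C \<noteq> 0" "n \<ge> 0" "\<bar>D\<bar> \<le> K" "K \<ge> 0"
  shows "n \<le> K ^ 3"
proof -
  have "1 * n \<le> \<bar>C\<bar> * n" using assms(2,3) by (intro mult_right_mono) auto
  also have "\<dots> = \<bar>D\<bar>" using assms(1,3) by (auto simp: abs_mult)
  also have "\<dots> \<le> K" by fact
  also have "\<dots> \<le> K ^ 3"
    using assms(5) self_le_power[of K 3] by (cases "K = 0") auto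
  finally show ?thesis by simp
qed

theorem theorem1p2:
  fixes A B :: int
  shows "(A = 0 \<and> B = 1 \<longrightarrow> solutions A B = {p. prime p}) \<and>
    (A = 1 \<and> B = 1 \<longrightarrow> solutions A B = {p ^ 2 | p. prime p}) \<and>
    ((A, B) \<noteq> (0, 1) \<and> (A, B) \<noteq> (1, 1) \<longrightarrow>
      (\<forall>n \<in> solutions A B. int n > (\<bar>A\<bar> + \<bar>B\<bar>) ^ 3 \<and> (A, B, n) \<noteq> (0, 0, 1) \<longrightarrow>
        (\<exists>p q. prime p \<and> prime q \<and> p < q \<and> n = p * q \<and>
          (int p)^2 + (int q)^2 + (1 - B) = A * int p * int q)))"
proof (intro conjI impI ballI)
  show "solutions A B = {p. prime p}" if "A = 0 \<and> B = 1"
    using that solutions_0_1 by simp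
  show "solutions A B = {p ^ 2 | p. prime p}" if "A = 1 \<and> B = 1"
    using that solutions_1_1 by simp
  fix n
  assume AB: "(A, B) \<noteq> (0, 1) \<and> (A, B) \<noteq> (1, 1)"
    and n: "n \<in> solutions A B"
    and large: "int n > (\<bar>A\<bar> + \<bar>B\<bar>) ^ 3 \<and> (A, B, n) \<noteq> (0, 0, 1)"
  have eq: "int (sigma2 n) - (int n)^2 = A * int n + B" and "n > 0"
    using n by (auto simp: solutions_def)
  from \<open>n > 0\<close> show "\<exists>p q. prime p \<and> prime q \<and> p < q \<and> n = p * q \<and>
          (int p)^2 + (int q)^2 + (1 - B) = A * int p * int q"
  proof (cases rule: nat_prime_factor_cases)
    case one
    \<comment> \<open>A cube below 1 forces \<open>A = B = 0\<close>, which is the excluded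
      triple.\<close>
    have "\<bar>A\<bar> + \<bar>B\<bar> < 1"
      using large one power_less_imp_less_base[of "\<bar>A\<bar> + \<bar>B\<bar>" 3 1] by simp
    then show ?thesis using large one by auto
  next
    case prime
    then have *: "A * int n = 1 - B"
      using eq by (simp add: sigma2_prime)
    \<comment> \<open>\<open>A = 0\<close> would give \<open>B = 1\<close>. Now
      \<open>\<bar>A\<bar> \<ge> 1\<close> absorbs the 1 in
      \<open>\<bar>1 - B\<bar>\<close>.\<close>
    then have "A \<noteq> 0" using AB by auto
    then have "int n \<le> (\<bar>A\<bar> + \<bar>B\<bar>) ^ 3"
      using le_cube_of_mult_eq[OF *] by simp
    then show ?thesis using large by simp
  next
    case (square p)
    \<comment> \<open>The divisor \<open>p\<close> contributes \<open>p ^ 2 = n\<close>, which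
      shifts the coefficient \<open>A\<close> by one.\<close>
    then have *: "(A - 1) * int n = 1 - B"
      using eq by (simp add: sigma2_prime_square algebra_simps)
    have "A \<noteq> 1" using AB * by auto
    \<comment> \<open>For \<open>A = 0\<close> no \<open>\<bar>A\<bar>\<close> is available to
      absorb the 1, but then \<open>B = n + 1\<close> is positive and
      \<open>\<bar>1 - B\<bar> \<le> \<bar>B\<bar>\<close>.\<close>
    moreover have "B \<ge> 1" if "A = 0"
      using * that by simp
    ultimately have "\<bar>1 - B\<bar> \<le> \<bar>A\<bar> + \<bar>B\<bar>" by (cases "A = 0") auto
    then have "int n \<le> (\<bar>A\<bar> + \<bar>B\<bar>) ^ 3"
      using \<open>A \<noteq> 1\<close> by (intro le_cube_of_mult_eq[OF *]) auto
    then show ?thesis using large by simp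
  next
    case (product p q)
    then have "(int p)^2 + (int q)^2 + (1 - B) = A * int p * int q"
      using eq by (simp add: sigma2_prime_product algebra_simps)
    then show ?thesis using product by blast
  next
    case (three p m)
    then show ?thesis
      using solution_three_less_cube[of p m A B] n large by simp
  qed
qed

end
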